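(* Let $H$ be a $\{1,3\}$-graph on a finite vertex set $[n]$. Suppose the order of a maximum complete $\{1,3\}$-subgraph of $H$ is $t$, where $t\ge 5$; the $3$-uniform hypergraph $H^3$ has a maximum complete $3$-subgraph (largest clique) of order $s$, where $s\ge t$; and the number of edges of $H^3$ satisfies $\binom{s}{3}\le e(H^3)\le \binom{s}{3}+\binom{t-1}{2}$. Then $$\lambda'(H)=\lambda'\left(K_t^{\{1,3\}}\right)=1+\frac{(t-1)(t-2)}{t^2}.$$
   Context: A hypergraph $H=(V,E)$ has edges that are subsets of $V$; its set of edge types is $R(H)=\{|F|:F\in E\}$, and $H$ is called an $R$-graph if $R(H)=R$. For $j\in R(H)$, $H^j$ (or $E^j$) denotes the $j$-uniform hypergraph of edges of $H$ of cardinality $j$, and $e(G)$ denotes the number of edges of a hypergraph $G$. The complete hypergraph $K_t^{R}$ has vertex set $[t]$ and edge set $\bigcup_{i\in R}\binom{[t]}{i}$. A complete $R$-subgraph of $H$ of order $t$ is a set of $t$ vertices all of whose subsets with cardinality in $R$ are edges of $H$. For $H$ with vertex set $[n]$ and $\vec x\in\mathbb{R}^n$, define $\lambda'(H,\vec x)=\sum_{j\in R(H)} j!\sum_{i_1i_2\ldots i_j\in H^j}x_{i_1}x_{i_2}\cdots x_{i_j}$, and $\lambda'(H)=\max\{\lambda'(H,\vec x): \vec x\in S\}$, where $S=\{\vec x\in\mathbb{R}^n:\sum_{i=1}^n x_i=1,\ x_i\ge 0\}$. *)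

theory Defs
  imports "HOL-Analysis.Analysis"
begin

type_synonym 'a hypergraph = "'a set \<times> 'a set set"

abbreviation verts :: "'a hypergraph \<Rightarrow> 'a set" where "verts H \<equiv> fst H"

abbreviation edges :: "'a hypergraph \<Rightarrow> 'a set set" where "edges H \<equiv> snd H"

definition hypergraph :: "'a hypergraph \<Rightarrow> bool" where
  "hypergraph H \<longleftrightarrow> finite (verts H) \<and> edges H \<subseteq> Pow (verts H)"

definition edge_types :: "'a hypergraph \<Rightarrow> nat set" where
  "edge_types H = card ` edges H"

definition R_graph :: "nat set \<Rightarrow> 'a hypergraph \<Rightarrow> bool" where
  "R_graph R H \<longleftrightarrow> hypergraph H \<and> edge_types H = R"

definition uniform_part :: "'a hypergraph \<Rightarrow> nat \<Rightarrow> 'a hypergraph" where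
  "uniform_part H j = (verts H, {F \<in> edges H. card F = j})"

definition num_edges :: "'a hypergraph \<Rightarrow> nat" where
  "num_edges H = card (edges H)"

definition complete_hypergraph :: "nat set \<Rightarrow> nat \<Rightarrow> nat hypergraph" where
  "complete_hypergraph R t = ({1..t}, \<Union>i\<in>R. {F. F \<subseteq> {1..t} \<and> card F = i})"

definition complete_subgraph :: "nat set \<Rightarrow> 'a hypergraph \<Rightarrow> 'a set \<Rightarrow> bool" where
  "complete_subgraph R H T \<longleftrightarrow>
     T \<subseteq> verts H \<and> (\<forall>F. F \<subseteq> T \<and> card F \<in> R \<longrightarrow> F \<in> edges H)"

definition max_complete_order :: "nat set \<Rightarrow> 'a hypergraph \<Rightarrow> nat" where
  "max_complete_order R H = Max {card T | T. complete_subgraph R H T}"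

text \<open>A vector indexed by a vertex set \<open>V\<close> is a function on the whole type of vertices
  whose values outside \<open>V\<close> are arbitrary and never used.\<close>

definition weight_simplex :: "'a set \<Rightarrow> ('a \<Rightarrow> real) set" where
  "weight_simplex V = {x. (\<forall>i\<in>V. 0 \<le> x i) \<and> (\<Sum>i\<in>V. x i) = 1}"

definition lagrangian_poly :: "'a hypergraph \<Rightarrow> ('a \<Rightarrow> real) \<Rightarrow> real" where
  "lagrangian_poly H x =
     (\<Sum>j\<in>edge_types H. fact j * (\<Sum>F\<in>edges (uniform_part H j). \<Prod>i\<in>F. x i))"

definition lagrangian :: "'a hypergraph \<Rightarrow> real" where
  "lagrangian H = (GREATEST m. m \<in> lagrangian_poly H ` weight_simplex (verts H))"

text \<open>The maximum in the definition of the Lagrangian exists, by compactness of the simplex.\<close>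

lemma lagrangian_poly_attains_max:
  assumes H: "hypergraph H" and ne: "verts H \<noteq> {}"
  shows "\<exists>x\<in>weight_simplex (verts H). \<forall>y\<in>weight_simplex (verts H).
           lagrangian_poly H y \<le> lagrangian_poly H x"
proof -
  define V where "V = verts H"
  have fin: "finite V" and sub: "edges H \<subseteq> Pow V"
    using H by (auto simp: hypergraph_def V_def)
  define B where "B = (\<Pi>\<^sub>E i\<in>UNIV. if i \<in> V then {0..1::real} else {0})"
  define K where "K = B \<inter> {x. (\<Sum>i\<in>V. x i) = 1}"
  have "compactin (product_topology (\<lambda>i. euclidean) UNIV) B"
    unfolding B_def by (subst compactin_PiE) auto
  then have "compact B"
    by (simp add: euclidean_product_topology)
  moreover have "closed {x :: 'a \<Rightarrow> real. (\<Sum>i\<in>V. x i) = 1}"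
    by (intro closed_Collect_eq continuous_intros) auto
  ultimately have cK: "compact K"
    unfolding K_def by (rule compact_Int_closed)
  have KS: "K \<subseteq> weight_simplex V"
    by (auto simp: K_def B_def weight_simplex_def PiE_iff split: if_splits)
  have cut: "(\<lambda>i. if i \<in> V then y i else 0) \<in> K" if y: "y \<in> weight_simplex V" for y
  proof -
    have "y i \<le> 1" if "i \<in> V" for i
      using y fin that member_le_sum[of i V y] by (auto simp: weight_simplex_def)
    then show ?thesis
      using y by (auto simp: K_def B_def weight_simplex_def)
  qed
  have poly_cut: "lagrangian_poly H (\<lambda>i. if i \<in> V then y i else 0) = lagrangian_poly H y" for y
    unfolding lagrangian_poly_def uniform_part_def using sub
    by (fastforce intro!: sum.cong prod.cong arg_cong2[where f = "(*)"])
  obtain v where v: "v \<in> V" using ne by (auto simp: V_def)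
  have "(\<lambda>i. if i = v then 1 else 0) \<in> weight_simplex V"
    using v fin by (auto simp: weight_simplex_def)
  then have "K \<noteq> {}" using cut by blast
  moreover have "continuous_on K (lagrangian_poly H)"
    unfolding lagrangian_poly_def
    by (intro continuous_intros continuous_on_product_coordinates
        continuous_on_subset[OF continuous_on_product_coordinates]) auto
  ultimately obtain x where "x \<in> K" "\<forall>y\<in>K. lagrangian_poly H y \<le> lagrangian_poly H x"
    using continuous_attains_sup[OF cK] by blast
  then show ?thesis
    using KS cut poly_cut unfolding V_def by (metis subsetD)
qed

lemma lagrangian_is_max:
  assumes "hypergraph H" and "verts H \<noteq> {}"
  shows "lagrangian H \<in> lagrangian_poly H ` weight_simplex (verts H)"
    and "x \<in> weight_simplex (verts H) \<Longrightarrow> lagrangian_poly H x \<le> lagrangian H"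
proof -
  obtain z where z: "z \<in> weight_simplex (verts H)"
    "\<forall>y\<in>weight_simplex (verts H). lagrangian_poly H y \<le> lagrangian_poly H z"
    using lagrangian_poly_attains_max[OF assms] by blast
  have "lagrangian H = lagrangian_poly H z"
    unfolding lagrangian_def by (rule Greatest_equality) (use z in auto)
  then show "lagrangian H \<in> lagrangian_poly H ` weight_simplex (verts H)"
    and "x \<in> weight_simplex (verts H) \<Longrightarrow> lagrangian_poly H x \<le> lagrangian H"
    using z by auto
qed

end

theory Submission
  imports Defs
begin

text \<open>For the upper bound, let \<open>S\<close> be a largest clique of the triple system. At most \<open>t\<close> vertices
  of \<open>S\<close> carry loops, so we may enlarge the loops to everything outside \<open>S - A\<close> for some
  \<open>A \<subseteq> S\<close> with \<open>|A| = t\<close>; at most \<open>(t - 1) choose 2\<close> triples are not contained in \<open>S\<close>. Maximise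
  over all weightings and all such configurations. Exchanging the roles of vertices of \<open>A\<close> and
  \<open>S - A\<close>, and compressing towards heavy vertices outside \<open>S\<close>, one may assume that \<open>A\<close> consists of the
  heaviest vertices. First-order optimality bounds the link of every vertex of \<open>A\<close> from below.
  Summing the links over \<open>A\<close> gives a quadratic form, which is bounded from above because \<open>t - 1\<close>
  pairs of \<open>A\<close> are missing from the link of each vertex outside \<open>S\<close>; this forces the value down to
  that of the uniform weighting on a complete subgraph of order \<open>t\<close>.\<close>

section \<open>Families of \<open>k\<close>-subsets, their edge sums and their links\<close>

definition ksubsets :: "nat \<Rightarrow> 'a set \<Rightarrow> 'a set set" where
  "ksubsets k S = {F. F \<subseteq> S \<and> card F = k}"

definition edge_sum :: "'a set set \<Rightarrow> ('a \<Rightarrow> real) \<Rightarrow> real" where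
  "edge_sum E x = (\<Sum>F\<in>E. \<Prod>i\<in>F. x i)"

text \<open>For a family of finite edges this is the partial derivative of \<open>edge_sum E\<close>
  with respect to the coordinate \<open>j\<close>.\<close>

definition link_sum :: "'a set set \<Rightarrow> 'a \<Rightarrow> ('a \<Rightarrow> real) \<Rightarrow> real" where
  "link_sum E j x = (\<Sum>F | F \<in> E \<and> j \<in> F. \<Prod>i\<in>F - {j}. x i)"

section \<open>Elementary symmetric sums\<close>

lemma finite_ksubsets [simp]: "finite S \<Longrightarrow> finite (ksubsets k S)"
  by (simp add: ksubsets_def)

lemma finite_subset_ksubsets:
  assumes "finite V" "E \<subseteq> ksubsets k V"
  shows "finite E" and "F \<in> E \<Longrightarrow> finite F"
proof -
  show "finite E" by (rule finite_subset[OF assms(2)]) (simp add: assms(1))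
  show "finite F" if "F \<in> E"
    by (rule finite_subset[OF _ assms(1)]) (use that assms(2) in \<open>auto simp: ksubsets_def\<close>)
qed

lemma ksubsets_0: "finite S \<Longrightarrow> ksubsets 0 S = {{}}"
  by (auto simp: ksubsets_def dest: finite_subset)

lemma ksubsets_insert:
  assumes "finite S" "a \<notin> S"
  shows "ksubsets (Suc k) (insert a S) = ksubsets (Suc k) S \<union> insert a ` ksubsets k S"
proof (intro equalityI subsetI)
  fix F assume F: "F \<in> ksubsets (Suc k) (insert a S)"
  then have fin: "finite F"
    using assms by (auto simp: ksubsets_def dest: finite_subset)
  show "F \<in> ksubsets (Suc k) S \<union> insert a ` ksubsets k S"
  proof (cases "a \<in> F")
    case True
    then have "F = insert a (F - {a})" "F - {a} \<in> ksubsets k S"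
      using F fin by (auto simp: ksubsets_def)
    then show ?thesis by blast
  qed (use F in \<open>auto simp: ksubsets_def\<close>)
next
  fix F assume "F \<in> ksubsets (Suc k) S \<union> insert a ` ksubsets k S"
  then show "F \<in> ksubsets (Suc k) (insert a S)"
  proof
    assume "F \<in> insert a ` ksubsets k S"
    then obtain G where G: "F = insert a G" "G \<subseteq> S" "card G = k"
      by (auto simp: ksubsets_def)
    moreover have "finite G" "a \<notin> G"
      using G assms finite_subset by auto
    ultimately show ?thesis by (auto simp: ksubsets_def)
  qed (auto simp: ksubsets_def)
qed

lemma edge_sum_ksubsets_insert:
  assumes "finite S" "a \<notin> S"
  shows "edge_sum (ksubsets (Suc k) (insert a S)) x
    = edge_sum (ksubsets (Suc k) S) x + x a * edge_sum (ksubsets k S) x"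
proof -
  have a: "a \<notin> G" "finite G" if "G \<in> ksubsets k S" for G
    using that assms by (auto simp: ksubsets_def dest: finite_subset)
  have "inj_on (insert a) (ksubsets k S)"
    using a(1) by (metis inj_onI insert_ident)
  then have "edge_sum (insert a ` ksubsets k S) x = (\<Sum>G\<in>ksubsets k S. \<Prod>i\<in>insert a G. x i)"
    unfolding edge_sum_def by (rule sum.reindex[unfolded o_def])
  also have "\<dots> = x a * edge_sum (ksubsets k S) x"
    unfolding edge_sum_def sum_distrib_left by (rule sum.cong) (use a in auto)
  finally have *: "edge_sum (insert a ` ksubsets k S) x = x a * edge_sum (ksubsets k S) x" .
  have "ksubsets (Suc k) S \<inter> insert a ` ksubsets k S = {}"
    using assms by (auto simp: ksubsets_def)
  then show ?thesis
    using * assms by (simp add: ksubsets_insert edge_sum_def sum.union_disjoint)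
qed

lemma edge_sum_ksubsets_0: "finite S \<Longrightarrow> edge_sum (ksubsets 0 S) x = 1"
  by (simp add: ksubsets_0 edge_sum_def)

lemma edge_sum_ksubsets_empty: "edge_sum (ksubsets (Suc k) {}) x = 0"
  by (auto simp: ksubsets_def edge_sum_def intro!: sum.neutral)

lemma edge_sum_ksubsets_1: "finite S \<Longrightarrow> edge_sum (ksubsets 1 S) x = sum x S"
  by (induction S rule: finite_induct)
    (simp_all add: edge_sum_ksubsets_insert edge_sum_ksubsets_0 edge_sum_ksubsets_empty)

lemma edge_sum_ksubsets_2:
  "finite S \<Longrightarrow> 2 * edge_sum (ksubsets 2 S) x = (sum x S)\<^sup>2 - (\<Sum>i\<in>S. (x i)\<^sup>2)"
proof (induction S rule: finite_induct)
  case empty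
  then show ?case using edge_sum_ksubsets_empty[of 1 x] by (simp add: numeral_2_eq_2)
next
  case (insert a S)
  then show ?case
    using edge_sum_ksubsets_insert[of S a 1 x] edge_sum_ksubsets_1[of S x]
    by (simp add: eval_nat_numeral algebra_simps)
qed

lemma edge_sum_ksubsets_3:
  "finite S \<Longrightarrow> 6 * edge_sum (ksubsets 3 S) x
     = (sum x S) ^ 3 - 3 * sum x S * (\<Sum>i\<in>S. (x i)\<^sup>2) + 2 * (\<Sum>i\<in>S. (x i) ^ 3)"
proof (induction S rule: finite_induct)
  case empty
  then show ?case using edge_sum_ksubsets_empty[of 2 x] by (simp add: numeral_3_eq_3 numeral_2_eq_2)
next
  case (insert a S)
  have "6 * edge_sum (ksubsets 3 (insert a S)) x
      = 6 * edge_sum (ksubsets 3 S) x + 3 * x a * (2 * edge_sum (ksubsets 2 S) x)"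
    using edge_sum_ksubsets_insert[of S a 2 x] insert by (simp add: numeral_3_eq_3 numeral_2_eq_2)
  then show ?case
    using insert unfolding edge_sum_ksubsets_2[OF insert(1)]
    by (simp add: power2_eq_square power3_eq_cube algebra_simps)
qed

text \<open>The bound holds termwise after subtracting the tangent of \<open>3 y\<^sup>2 - 2 y\<^sup>3\<close> at \<open>1 / t\<close>.\<close>

lemma edge_sum_ksubsets_3_le:
  assumes "finite S" "card S = t" "t \<ge> 4" "\<And>i. i \<in> S \<Longrightarrow> 0 \<le> x i" "sum x S = 1"
  shows "6 * edge_sum (ksubsets 3 S) x \<le> (real t - 1) * (real t - 2) / (real t)\<^sup>2"
proof -
  define u where "u = 1 / real t"
  have u: "real t * u = 1" "u \<le> 1 / 4" using assms(3) by (auto simp: u_def field_simps)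
  have "3 * u\<^sup>2 - 2 * u ^ 3 + (6 * u - 6 * u\<^sup>2) * (x i - u) \<le> 3 * (x i)\<^sup>2 - 2 * (x i) ^ 3"
    if i: "i \<in> S" for i
  proof -
    have "x i \<le> 1" using member_le_sum[of i S x] assms i by auto
    \<comment> \<open>The cubic minus its tangent at \<open>u\<close> equals this product. Its last
      factor is nonnegative because \<open>x i \<le> 1\<close> and \<open>u \<le> 1 / 4\<close>,
      which is where \<open>t \<ge> 4\<close> enters.\<close>
    then have "0 \<le> (x i - u)\<^sup>2 * (3 - 2 * x i - 4 * u)" using u by simp
    then show ?thesis by (simp add: power2_eq_square power3_eq_cube algebra_simps)
  qed
  then have "(\<Sum>i\<in>S. 3 * u\<^sup>2 - 2 * u ^ 3 + (6 * u - 6 * u\<^sup>2) * (x i - u))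
      \<le> (\<Sum>i\<in>S. 3 * (x i)\<^sup>2 - 2 * (x i) ^ 3)"
    by (rule sum_mono)
  also have "(\<Sum>i\<in>S. 3 * u\<^sup>2 - 2 * u ^ 3 + (6 * u - 6 * u\<^sup>2) * (x i - u))
      = real t * (3 * u\<^sup>2 - 2 * u ^ 3) + (6 * u - 6 * u\<^sup>2) * (sum x S - real t * u)"
    using assms(2) by (simp add: sum.distrib sum_subtractf sum_distrib_left[symmetric])
  also have "\<dots> = (real t * u) * (3 * u - 2 * u\<^sup>2)"
    unfolding assms(5) u(1) using u(1) by (simp add: power2_eq_square power3_eq_cube) algebra
  also have "\<dots> = 3 * u - 2 * u\<^sup>2" using u by simp
  finally have "3 * u - 2 * u\<^sup>2 \<le> 3 * (\<Sum>i\<in>S. (x i)\<^sup>2) - 2 * (\<Sum>i\<in>S. (x i) ^ 3)"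
    by (simp add: sum_subtractf sum_distrib_left)
  moreover have "(real t - 1) * (real t - 2) / (real t)\<^sup>2 = 1 - 3 * u + 2 * u\<^sup>2"
    using assms(3) by (simp add: u_def field_simps power2_eq_square)
  ultimately show ?thesis
    using edge_sum_ksubsets_3[of S x] assms by simp
qed

section \<open>Graphs with few missing edges\<close>

lemma sum_degree_weight:
  fixes g :: "'a \<Rightarrow> real"
  assumes "finite A" "M \<subseteq> ksubsets k A"
  shows "(\<Sum>e\<in>M. sum g e) = (\<Sum>j\<in>A. real (card {e \<in> M. j \<in> e}) * g j)"
proof -
  have fin: "finite M" using assms finite_subset by fastforce
  have "(\<Sum>e\<in>M. sum g e) = (\<Sum>e\<in>M. \<Sum>j | j \<in> A \<and> j \<in> e. g j)"
    using assms by (intro sum.cong) (auto simp: ksubsets_def intro!: arg_cong[where f = "sum g"])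
  also have "\<dots> = (\<Sum>j\<in>A. \<Sum>e | e \<in> M \<and> j \<in> e. g j)"
    by (rule sum.swap_restrict[OF fin assms(1)])
  finally show ?thesis by simp
qed

lemma ksubsets_2E:
  assumes "e \<in> ksubsets 2 A"
  obtains j k where "e = {j, k}" "j \<noteq> k" "j \<in> A" "k \<in> A"
  using assms by (auto simp: ksubsets_def card_2_iff)

text \<open>Double counting turns the left side into the sum, over the edges of \<open>M\<close>, of
  their endpoint degrees. Only the edge itself contains both of its endpoints, so the two degrees
  count at most one edge twice and add up to at most \<open>card M + 1\<close>.\<close>

lemma sum_degree_squares_le:
  assumes "finite A" "M \<subseteq> ksubsets 2 A"
  shows "(\<Sum>j\<in>A. (real (card {e \<in> M. j \<in> e}))\<^sup>2) \<le> real (card M) * (real (card M) + 1)"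
proof -
  let ?deg = "\<lambda>j. card {e \<in> M. j \<in> e}"
  have fin: "finite M" using assms finite_subset by fastforce
  have "(\<Sum>j\<in>e. real (?deg j)) \<le> real (card M) + 1" if e: "e \<in> M" for e
  proof -
    obtain j k where jk: "e = {j, k}" "j \<noteq> k"
      using e assms(2) by (meson ksubsets_2E subsetD)
    have "{e \<in> M. j \<in> e} \<inter> {e \<in> M. k \<in> e} \<subseteq> {e}"
      using assms(2) jk by (auto simp: ksubsets_def card_2_iff)
    then have "card ({e \<in> M. j \<in> e} \<inter> {e \<in> M. k \<in> e}) \<le> 1"
      using card_mono[of "{e}"] by fastforce
    moreover have "card ({e \<in> M. j \<in> e} \<union> {e \<in> M. k \<in> e}) \<le> card M"
      by (rule card_mono) (use fin in auto)
    ultimately have "?deg j + ?deg k \<le> card M + 1"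
      using card_Un_Int[of "{e \<in> M. j \<in> e}" "{e \<in> M. k \<in> e}"] fin by simp
    then show ?thesis using jk by simp
  qed
  then have "(\<Sum>e\<in>M. \<Sum>j\<in>e. real (?deg j)) \<le> (\<Sum>e\<in>M. real (card M) + 1)"
    by (rule sum_mono)
  then show ?thesis
    using sum_degree_weight[OF assms, of "\<lambda>j. real (?deg j)"] by (simp add: power2_eq_square)
qed

lemma sum_ksubsets_2_weight:
  fixes g :: "'a \<Rightarrow> real"
  assumes "finite A"
  shows "(\<Sum>e\<in>ksubsets 2 A. sum g e) = (real (card A) - 1) * sum g A"
proof -
  have "real (card {e \<in> ksubsets 2 A. j \<in> e}) = real (card A) - 1" if j: "j \<in> A" for j
  proof -
    have "{e \<in> ksubsets 2 A. j \<in> e} = (\<lambda>k. {j, k}) ` (A - {j})"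
      using j by (auto simp: ksubsets_def card_2_iff)
    moreover have "inj_on (\<lambda>k. {j, k}) (A - {j})"
      by (auto simp: inj_on_def doubleton_eq_iff)
    ultimately have "card {e \<in> ksubsets 2 A. j \<in> e} = card A - 1"
      using j assms by (simp add: card_image)
    moreover have "card A \<ge> 1"
      using j assms by (metis One_nat_def Suc_leI card_gt_0_iff empty_iff)
    ultimately show ?thesis by simp
  qed
  then show ?thesis
    using sum_degree_weight[OF assms subset_refl, of g] by (simp add: sum_distrib_left)
qed

text \<open>Since \<open>G\<close> and the \<open>c\<close> surplus edges number at most \<open>(t - 1) choose 2\<close>, at least \<open>t - 1\<close>
  pairs remain unused. The degree sequence of \<open>t - 1\<close> pairs has square sum at most \<open>t (t - 1)\<close>,
  with equality for a star, which is what makes the estimate sharp.\<close>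

lemma few_edges_weight_le:
  fixes y :: "'a \<Rightarrow> real"
  assumes A: "finite A" "card A = t" "t \<ge> 3" and G: "G \<subseteq> ksubsets 2 A"
    and c: "card G + c \<le> (t - 1) choose 2" and m: "0 \<le> m" "\<And>j. j \<in> A \<Longrightarrow> m \<le> y j"
    and d: "0 \<le> d"
  shows "d * ((\<Sum>e\<in>G. sum y e) + real c * (2 * m))
    \<le> (real t - 1) * (real t - 2) / real t * d * sum y A
      + (real t - 2) / 2 * ((\<Sum>j\<in>A. (y j)\<^sup>2) - (sum y A)\<^sup>2 / real t + d\<^sup>2 * (real t - 1) / real t)"
proof -
  define N where "N = ksubsets 2 A - G"
  have finK: "finite (ksubsets 2 A)" and finG: "finite G"
    using A G finite_subset by fastforce+
  have "card (ksubsets 2 A) = t choose 2"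
    using A by (simp add: ksubsets_def n_subsets)
  also have "t choose 2 = (t - 1) + ((t - 1) choose 2)"
    using A(3) by (cases t) (simp_all add: numeral_2_eq_2)
  finally have "card N \<ge> t - 1 + c"
    using c finG G by (simp add: N_def card_Diff_subset)
  moreover obtain M where M: "M \<subseteq> N" "card M = t - 1" "finite M"
    using obtain_subset_with_card_n[of "t - 1" N] \<open>card N \<ge> t - 1 + c\<close> by auto
  ultimately have cNM: "c \<le> card (N - M)"
    by (simp add: card_Diff_subset)
  have "real c * (2 * m) \<le> real (card (N - M)) * (2 * m)"
    using cNM m(1) by (intro mult_right_mono) auto
  also have "\<dots> = (\<Sum>e\<in>N - M. 2 * m)" by simp
  also have "\<dots> \<le> (\<Sum>e\<in>N - M. sum y e)"
  proof (rule sum_mono)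
    fix e assume "e \<in> N - M"
    then obtain j k where "e = {j, k}" "j \<noteq> k" "j \<in> A" "k \<in> A"
      unfolding N_def by (meson DiffD1 ksubsets_2E)
    then show "2 * m \<le> sum y e" using m(2)[of j] m(2)[of k] by simp
  qed
  finally have "(\<Sum>e\<in>G. sum y e) + real c * (2 * m) \<le> (\<Sum>e\<in>G. sum y e) + (\<Sum>e\<in>N - M. sum y e)"
    by simp
  also have "\<dots> = (\<Sum>e\<in>ksubsets 2 A. sum y e) - (\<Sum>e\<in>M. sum y e)"
  proof -
    have "(\<Sum>e\<in>ksubsets 2 A. sum y e) = (\<Sum>e\<in>G. sum y e) + (\<Sum>e\<in>N. sum y e)"
      unfolding N_def using sum.subset_diff[OF G finK] by (simp add: add.commute)
    moreover have "(\<Sum>e\<in>N. sum y e) = (\<Sum>e\<in>M. sum y e) + (\<Sum>e\<in>N - M. sum y e)"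
      using sum.subset_diff[OF M(1)] finK by (simp add: N_def add.commute)
    ultimately show ?thesis by simp
  qed
  finally have le: "(\<Sum>e\<in>G. sum y e) + real c * (2 * m)
      \<le> (real t - 1) * sum y A - (\<Sum>e\<in>M. sum y e)"
    using sum_ksubsets_2_weight[OF A(1), of y] A by simp
  define dg where "dg j = real (card {e \<in> M. j \<in> e})" for j
  have MK: "M \<subseteq> ksubsets 2 A" using M by (auto simp: N_def)
  have My: "(\<Sum>e\<in>M. sum y e) = (\<Sum>j\<in>A. dg j * y j)"
    unfolding dg_def by (rule sum_degree_weight[OF A(1) MK])
  have rt: "real (card M) = real t - 1" using M A by simp
  have "(\<Sum>j\<in>A. dg j) = (\<Sum>e\<in>M. sum (\<lambda>_. 1) e)"
    using sum_degree_weight[OF A(1) MK, of "\<lambda>_. 1"] by (simp add: dg_def)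
  also have "\<dots> = (\<Sum>e\<in>M. 2)"
    using MK by (intro sum.cong) (auto simp: ksubsets_def)
  finally have d1: "(\<Sum>j\<in>A. dg j) = 2 * (real t - 1)" using rt by simp
  have d2: "(\<Sum>j\<in>A. (dg j)\<^sup>2) \<le> (real t - 1) * real t"
    using sum_degree_squares_le[OF A(1) MK] rt by (simp add: dg_def)
  define Y where "Y = sum y A"
  define Q where "Q = (\<Sum>j\<in>A. (y j)\<^sup>2)"
  define R where "R = (\<Sum>j\<in>A. dg j * y j)"
  define T where "T = real t"
  have T: "T \<ge> 3" using A by (simp add: T_def)
  \<comment> \<open>\<open>\<mu>\<close> and \<open>v\<close> are the means of \<open>dg\<close> and
    \<open>y\<close> over \<open>A\<close>. The factor \<open>T - 2\<close> in the square below
    makes every summand vanish when \<open>M\<close> is a star on all of \<open>A\<close> with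
    equally heavy leaves and a centre lighter by \<open>d\<close>. This is the situation of a clique
    vertex split into two twins, one of them in \<open>A\<close> and the other outside with weight
    \<open>d\<close>.\<close>
  define \<mu> where "\<mu> = 2 * (T - 1) / T"
  define v where "v = Y / T"
  have "0 \<le> (\<Sum>j\<in>A. (d * (dg j - \<mu>) + (T - 2) * (y j - v))\<^sup>2)"
    by (rule sum_nonneg) simp
  also have "\<dots> = (\<Sum>j\<in>A. d\<^sup>2 * (dg j)\<^sup>2 + (T - 2)\<^sup>2 * (y j)\<^sup>2 + 2 * d * (T - 2) * (dg j * y j)
      - 2 * d * (d * \<mu> + (T - 2) * v) * dg j - 2 * (T - 2) * (d * \<mu> + (T - 2) * v) * y j
      + (d * \<mu> + (T - 2) * v)\<^sup>2)"
    by (rule sum.cong) (simp_all add: power2_eq_square algebra_simps)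
  also have "\<dots> = d\<^sup>2 * (\<Sum>j\<in>A. (dg j)\<^sup>2) + (T - 2)\<^sup>2 * Q + 2 * d * (T - 2) * R
      - 2 * d * (d * \<mu> + (T - 2) * v) * (2 * (T - 1)) - 2 * (T - 2) * (d * \<mu> + (T - 2) * v) * Y
      + T * (d * \<mu> + (T - 2) * v)\<^sup>2"
    using A(2) d1 by (simp add: sum.distrib sum_subtractf sum_distrib_left[symmetric] Q_def R_def Y_def T_def)
  also have "\<dots> \<le> d\<^sup>2 * ((T - 1) * T) + (T - 2)\<^sup>2 * Q + 2 * d * (T - 2) * R
      - 2 * d * (d * \<mu> + (T - 2) * v) * (2 * (T - 1)) - 2 * (T - 2) * (d * \<mu> + (T - 2) * v) * Y
      + T * (d * \<mu> + (T - 2) * v)\<^sup>2"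
    using d2 by (simp add: T_def mult_left_mono)
  also have "\<dots> = (T - 2) * ((T - 2) * (Q - Y\<^sup>2 / T + d\<^sup>2 * (T - 1) / T)
      + 2 * d * R - 4 * d * (T - 1) / T * Y)"
    using T unfolding \<mu>_def v_def by (simp add: field_simps power2_eq_square)
  finally have sq: "0 \<le> (T - 2) * (Q - Y\<^sup>2 / T + d\<^sup>2 * (T - 1) / T)
      + 2 * d * R - 4 * d * (T - 1) / T * Y"
    using T by (simp add: zero_le_mult_iff)
  have aux: "e - (b - c) / 2 \<le> e + a / 2" if "0 \<le> a + b - c" for a b c e :: real
    using that by argo
  have "d * ((\<Sum>e\<in>G. sum y e) + real c * (2 * m)) \<le> d * ((T - 1) * Y - R)"
    using le d My by (intro mult_left_mono) (simp_all add: T_def Y_def R_def)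
  also have "\<dots> = (T - 1) * (T - 2) / T * d * Y - (2 * d * R - 4 * d * (T - 1) / T * Y) / 2"
    using T by (simp add: field_simps)
  also have "\<dots> \<le> (T - 1) * (T - 2) / T * d * Y
      + ((T - 2) * (Q - Y\<^sup>2 / T + d\<^sup>2 * (T - 1) / T)) / 2"
    by (rule aux[OF sq])
  finally show ?thesis
    unfolding T_def[symmetric] Y_def[symmetric] Q_def[symmetric] by simp
qed

section \<open>Links\<close>

lemma link_sum_ksubsets:
  assumes "finite S" "j \<in> S"
  shows "link_sum (ksubsets (Suc k) S) j x = edge_sum (ksubsets k (S - {j})) x"
  unfolding link_sum_def edge_sum_def
proof (rule sum.reindex_bij_witness[where i = "insert j" and j = "\<lambda>F. F - {j}"])
  fix G assume G: "G \<in> ksubsets k (S - {j})"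
  then have "finite G" "j \<notin> G" using assms by (auto simp: ksubsets_def dest: finite_subset)
  then show "insert j G \<in> {F \<in> ksubsets (Suc k) S. j \<in> F}" "insert j G - {j} = G"
    using G assms by (auto simp: ksubsets_def)
qed (use assms in \<open>auto simp: ksubsets_def insert_absorb dest: finite_subset\<close>)

lemma edge_sum_decrease:
  assumes "finite E" "\<And>F. F \<in> E \<Longrightarrow> finite F"
  shows "edge_sum E (x(j := x j - \<delta>)) = edge_sum E x - \<delta> * link_sum E j x"
proof -
  have "(\<Prod>i\<in>F. (x(j := x j - \<delta>)) i) = (\<Prod>i\<in>F. x i) - \<delta> * (if j \<in> F then \<Prod>i\<in>F - {j}. x i else 0)"
    if F: "F \<in> E" for F
  proof (cases "j \<in> F")
    case True
    have "(\<Prod>i\<in>F - {j}. (x(j := x j - \<delta>)) i) = (\<Prod>i\<in>F - {j}. x i)"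
      by (rule prod.cong) auto
    then show ?thesis
      using True prod.remove[OF assms(2)[OF F] True, of x]
        prod.remove[OF assms(2)[OF F] True, of "x(j := x j - \<delta>)"]
      by (simp add: algebra_simps)
  next
    case False
    then show ?thesis by (auto intro!: prod.cong)
  qed
  then show ?thesis
    using assms(1)
    by (simp add: edge_sum_def link_sum_def sum_subtractf sum_distrib_left sum.inter_filter
        cong: sum.cong if_cong)
qed

lemma edge_sum_divide:
  assumes "E \<subseteq> ksubsets k V"
  shows "edge_sum E (\<lambda>i. x i / c) = edge_sum E x / c ^ k"
proof -
  have "(\<Prod>i\<in>F. x i / c) = (\<Prod>i\<in>F. x i) / c ^ k" if "F \<in> E" for F
    using that assms by (auto simp: ksubsets_def prod_dividef)
  then show ?thesis by (simp add: edge_sum_def sum_divide_distrib)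
qed

lemma edge_sum_nonneg:
  assumes "E \<subseteq> ksubsets k V" "\<And>i. i \<in> V \<Longrightarrow> 0 \<le> x i"
  shows "0 \<le> edge_sum E x"
proof -
  have "0 \<le> x i" if "F \<in> E" "i \<in> F" for F i
    using that assms(1) by (intro assms(2)) (auto simp: ksubsets_def)
  then show ?thesis unfolding edge_sum_def by (auto intro!: sum_nonneg prod_nonneg)
qed

text \<open>First-order optimality, obtained by lowering the weight of \<open>j\<close> and rescaling.\<close>

lemma link_sum_ge_of_maximal:
  assumes V: "finite V" and E: "E \<subseteq> ksubsets 3 V" and L: "L \<subseteq> V"
    and x: "x \<in> weight_simplex V"
    and max: "\<And>y. y \<in> weight_simplex V
      \<Longrightarrow> sum y L + 6 * edge_sum E y \<le> sum x L + 6 * edge_sum E x"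
    and j: "j \<in> L" "0 < x j"
  shows "18 * edge_sum E x - (1 - sum x L) \<le> 6 * link_sum E j x"
proof -
  define \<Sigma> where "\<Sigma> = edge_sum E x"
  define l where "l = link_sum E j x"
  define b where "b = 1 - sum x L"
  have x0: "\<And>i. i \<in> V \<Longrightarrow> 0 \<le> x i" and x1: "sum x V = 1"
    using x by (auto simp: weight_simplex_def)
  have \<Sigma>0: "0 \<le> \<Sigma>" unfolding \<Sigma>_def by (rule edge_sum_nonneg[OF E x0])
  have b0: "0 \<le> b" using sum_mono2[OF V L, of x] x0 x1 by (auto simp: b_def)
  have xj: "x j \<le> 1" using member_le_sum[of j V x] V L j x0 x1 by auto
  note finE = finite_subset_ksubsets[OF V E]
  \<comment> \<open>As \<open>\<delta>\<close> tends to 0 this says that the derivative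
    \<open>1 + 6 * l\<close> at \<open>j\<close> is at least the weighted sum of all derivatives,
    which by Euler's identity is \<open>sum x L + 18 * \<Sigma>\<close>. For a fixed
    \<open>\<delta>\<close> the error is at most \<open>18 * \<Sigma> * \<delta>\<close>.\<close>
  have step: "18 * \<Sigma> - b - 6 * l \<le> 18 * \<Sigma> * \<delta>" if \<delta>: "0 < \<delta>" "\<delta> < x j" for \<delta>
  proof -
    define z where "z = x(j := x j - \<delta>)"
    define y where "y = (\<lambda>i. z i / (1 - \<delta>))"
    have \<delta>1: "0 < 1 - \<delta>" using \<delta> xj by simp
    have sumz: "sum z W = sum x W - \<delta>" if "finite W" "j \<in> W" for W
      using that by (simp add: z_def sum.remove[of W j])
    have jV: "j \<in> V" and finL: "finite L" using j L V finite_subset by auto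
    have "y \<in> weight_simplex V"
      unfolding weight_simplex_def
      using sumz[OF V jV] \<delta> \<delta>1 x0 x1
      by (auto simp: y_def z_def sum_divide_distrib[symmetric] intro!: divide_nonneg_pos)
    from max[OF this] have
      "(sum x L - \<delta>) / (1 - \<delta>) + 6 * ((\<Sigma> - \<delta> * l) / (1 - \<delta>) ^ 3) \<le> sum x L + 6 * \<Sigma>"
      using sumz[OF finL j(1)] edge_sum_divide[OF E, of z "1 - \<delta>"]
        edge_sum_decrease[OF finE, of x j \<delta>]
      by (simp add: y_def sum_divide_distrib[symmetric] \<Sigma>_def l_def z_def)
    then have "((sum x L - \<delta>) / (1 - \<delta>) + 6 * ((\<Sigma> - \<delta> * l) / (1 - \<delta>) ^ 3)) * (1 - \<delta>) ^ 3
        \<le> (sum x L + 6 * \<Sigma>) * (1 - \<delta>) ^ 3"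
      using \<delta>1 by (intro mult_right_mono) auto
    then have "(1 - b - \<delta>) * (1 - \<delta>)\<^sup>2 + 6 * (\<Sigma> - \<delta> * l) \<le> (1 - b + 6 * \<Sigma>) * (1 - \<delta>) ^ 3"
      using \<delta>1 by (simp add: b_def distrib_right power3_eq_cube power2_eq_square)
    then have "\<delta> * (18 * \<Sigma> - 18 * \<Sigma> * \<delta> + 6 * \<Sigma> * \<delta>\<^sup>2 - b * (1 - \<delta>)\<^sup>2 - 6 * l) \<le> 0"
      by (simp add: algebra_simps power3_eq_cube power2_eq_square)
    then have "18 * \<Sigma> - 18 * \<Sigma> * \<delta> + 6 * \<Sigma> * \<delta>\<^sup>2 - b * (1 - \<delta>)\<^sup>2 - 6 * l \<le> 0"
      using \<delta>(1) by (simp add: mult_le_0_iff)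
    moreover have "b * (1 - \<delta>)\<^sup>2 \<le> b * 1"
      using b0 \<delta>1 \<delta> by (intro mult_left_mono) (auto simp: power_le_one)
    moreover have "0 \<le> 6 * \<Sigma> * \<delta>\<^sup>2" using \<Sigma>0 by simp
    ultimately show ?thesis by linarith
  qed
  have "18 * \<Sigma> - b - 6 * l \<le> 0"
  proof (rule ccontr)
    assume "\<not> ?thesis"
    then have K: "0 < 18 * \<Sigma> - b - 6 * l" (is "0 < ?K") by simp
    \<comment> \<open>Small enough to stay below \<open>x j\<close> and to keep the error at most
      half of \<open>?K\<close>. The \<open>+ 1\<close> keeps the denominator positive when
      \<open>\<Sigma> = 0\<close>.\<close>
    define \<delta> where "\<delta> = min (x j / 2) (?K / (2 * (18 * \<Sigma> + 1)))"
    have "0 < \<delta>" "\<delta> < x j" using j K \<Sigma>0 by (auto simp: \<delta>_def min_less_iff_disj)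
    then have "?K \<le> 18 * \<Sigma> * \<delta>" by (rule step)
    also have "\<dots> \<le> (18 * \<Sigma> + 1) * \<delta>" using \<open>0 < \<delta>\<close> by (simp add: distrib_right)
    also have "\<dots> \<le> (18 * \<Sigma> + 1) * (?K / (2 * (18 * \<Sigma> + 1)))"
      using \<Sigma>0 by (intro mult_left_mono) (auto simp: \<delta>_def)
    also have "\<dots> = ?K / 2" using \<Sigma>0 by (simp add: field_simps)
    finally show False using K by simp
  qed
  then show ?thesis by (simp add: \<Sigma>_def b_def l_def)
qed

text \<open>Each triple of \<open>E\<close> is charged to one of its vertices in \<open>D\<close>.
  The triples charged to a fixed \<open>i\<close> act like a graph on \<open>A\<close> with surplus
  edges, to which \<open>few_edges_weight_le\<close> applies. Averaging these bounds with the
  weights \<open>x i\<close> treats the weight of \<open>D\<close> as if it sat on a single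
  vertex.\<close>

lemma sum_link_sum_extra_le:
  assumes V: "finite V" "A \<subseteq> V" "D \<subseteq> V - A" and t: "card A = t" "t \<ge> 3"
    and E: "E \<subseteq> ksubsets 3 V" "card E \<le> (t - 1) choose 2" "\<And>F. F \<in> E \<Longrightarrow> F \<inter> D \<noteq> {}"
    and x: "\<And>i. i \<in> V \<Longrightarrow> 0 \<le> x i" "\<And>i j. i \<in> V - A \<Longrightarrow> j \<in> A \<Longrightarrow> x i \<le> x j"
  shows "(\<Sum>j\<in>A. link_sum E j x)
    \<le> (real t - 1) * (real t - 2) / real t * sum x D * sum x A
      + (real t - 2) / 2 * ((\<Sum>j\<in>A. (x j)\<^sup>2) - (sum x A)\<^sup>2 / real t
          + (sum x D)\<^sup>2 * (real t - 1) / real t)" (is "_ \<le> ?B")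
proof -
  have finA: "finite A" and finD: "finite D"
    using finite_subset[OF V(2,1)] finite_subset[OF V(3)] V(1) by auto
  note finE = finite_subset_ksubsets(1)[OF V(1) E(1)]
  have Ane: "A \<noteq> {}" using t by auto
  define m where "m = Min (x ` A)"
  have m: "0 \<le> m" "\<And>j. j \<in> A \<Longrightarrow> m \<le> x j" "\<And>i. i \<in> V - A \<Longrightarrow> x i \<le> m"
    using finA Ane x V by (auto simp: m_def)
  define d where "d = sum x D"
  have xD: "0 \<le> x i" if "i \<in> D" for i using that V(3) x(1) by blast
  then have d0: "0 \<le> d" unfolding d_def by (rule sum_nonneg)
  define g where "g F = (\<Sum>j | j \<in> A \<and> j \<in> F. \<Prod>i\<in>F - {j}. x i)" for F
  define r where "r F = (SOME i. i \<in> F \<inter> D)" for F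
  have r: "r F \<in> F \<inter> D" if "F \<in> E" for F
    unfolding r_def some_in_eq by (rule E(3)[OF that])
  \<comment> \<open>A triple charged to \<open>i\<close> with two vertices in \<open>A\<close> is
    recorded in \<open>G i\<close> by that pair. Any other one meets \<open>A\<close> in at most one
    vertex, so it occurs in at most one of the links and contributes at most \<open>x i * m\<close>.
    The cruder \<open>2 * m\<close> matches the surplus term of
    \<open>few_edges_weight_le\<close>.\<close>
  define c where "c i = card {F \<in> E. r F = i \<and> card (F \<inter> A) \<noteq> 2}" for i
  define G where "G i = (\<lambda>F. F \<inter> A) ` {F \<in> E. r F = i \<and> card (F \<inter> A) = 2}" for i
  define w where "w i = (\<Sum>e\<in>G i. sum x e) + real (c i) * (2 * m)" for i
  have shape: "\<exists>i j k. r F = i \<and> F = {i, j, k} \<and> i \<noteq> j \<and> i \<noteq> k \<and> j \<noteq> k \<and> i \<in> V \<and> i \<notin> A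
      \<and> j \<in> V \<and> k \<in> V" if F: "F \<in> E" for F
  proof -
    have F3: "card F = 3" "F \<subseteq> V" using F E(1) by (auto simp: ksubsets_def)
    then have "card (F - {r F}) = 2" using r[OF F] by (simp add: card_Diff_singleton)
    then obtain j k where jk: "F - {r F} = {j, k}" "j \<noteq> k" by (auto simp: card_2_iff)
    have "F = {r F, j, k}" using jk r[OF F] by blast
    moreover have "r F \<noteq> j" "r F \<noteq> k" "j \<in> V" "k \<in> V" using jk F3 by blast+
    moreover have "r F \<in> V" "r F \<notin> A" using r[OF F] V by blast+
    ultimately show ?thesis using jk(2) by (intro exI[of _ "r F"] exI[of _ j] exI[of _ k]) simp
  qed
  have two: "F = insert (r F) (F \<inter> A) \<and> g F = x (r F) * sum x (F \<inter> A)"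
    if F: "F \<in> E" "card (F \<inter> A) = 2" for F
  proof -
    obtain i j k where i: "r F = i" and jk: "F = {i, j, k}" "i \<noteq> j" "i \<noteq> k" "j \<noteq> k" "i \<notin> A"
      using shape[OF F(1)] by blast
    have sub: "F \<inter> A \<subseteq> {j, k}" using jk by blast
    have FA: "F \<inter> A = {j, k}"
      by (rule card_subset_eq[OF _ sub]) (use F(2) jk(4) in auto)
    then have "{l. l \<in> A \<and> l \<in> F} = {j, k}" by blast
    moreover have "F - {j} = {i, k}" "F - {k} = {i, j}" using jk by blast+
    ultimately have "g F = x i * x k + x i * x j"
      using jk(2-4) unfolding g_def by simp
    then have "g F = x i * sum x (F \<inter> A)" using FA jk(4) by (simp add: algebra_simps)
    then show ?thesis unfolding i FA using jk(1) by simp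
  qed
  have one: "g F \<le> x (r F) * (2 * m)" if F: "F \<in> E" "card (F \<inter> A) \<noteq> 2" for F
  proof -
    obtain i j k where i: "r F = i" and jk: "F = {i, j, k}" "i \<noteq> j" "i \<noteq> k" "j \<noteq> k" "i \<notin> A" "i \<in> V"
      "j \<in> V" "k \<in> V"
      using shape[OF F(1)] by blast
    have *: "g F \<le> x i * (2 * m)"
      if jk: "F = {i, j, k}" "i \<noteq> j" "i \<noteq> k" "j \<noteq> k" "k \<in> V - A" for j k
    proof (cases "j \<in> A")
      case True
      then have "{l. l \<in> A \<and> l \<in> F} = {j}" "F - {j} = {i, k}"
        using jk \<open>i \<notin> A\<close> by blast+
      then have "g F = x i * x k" using jk(3) unfolding g_def by simp
      also have "\<dots> \<le> x i * (2 * m)"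
        using m(1) m(3)[OF jk(5)] x(1)[OF \<open>i \<in> V\<close>] by (intro mult_left_mono) auto
      finally show ?thesis .
    next
      case False
      then have "{l. l \<in> A \<and> l \<in> F} = {}" using jk \<open>i \<notin> A\<close> by blast
      then have "g F = 0" unfolding g_def by (simp only: sum.empty)
      then show ?thesis using m(1) x(1)[OF \<open>i \<in> V\<close>] by simp
    qed
    have "j \<notin> A \<or> k \<notin> A"
    proof (rule ccontr)
      assume "\<not> ?thesis"
      then have "F \<inter> A = {j, k}" using jk by blast
      then show False using F(2) jk(4) by simp
    qed
    then show ?thesis
    proof
      assume "k \<notin> A"
      then show ?thesis unfolding i using jk by (intro *[of j k]) auto
    next
      assume "j \<notin> A"
      then show ?thesis unfolding i using jk by (intro *[of k j]) auto
    qed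
  qed
  have group: "(\<Sum>F\<in>{F \<in> E. r F = i}. g F) \<le> x i * w i" for i
  proof -
    let ?P = "{F \<in> E. r F = i \<and> card (F \<inter> A) = 2}" and ?Q = "{F \<in> E. r F = i \<and> card (F \<inter> A) \<noteq> 2}"
    have inj: "inj_on (\<lambda>F. F \<inter> A) ?P"
    proof (rule inj_onI)
      fix F F' assume F: "F \<in> ?P" "F' \<in> ?P" "F \<inter> A = F' \<inter> A"
      then have "insert (r F) (F \<inter> A) = insert (r F') (F' \<inter> A)" by simp
      then show "F = F'" using two[of F] two[of F'] F(1,2) by blast
    qed
    have "(\<Sum>F\<in>{F \<in> E. r F = i}. g F) = (\<Sum>F\<in>?P. g F) + (\<Sum>F\<in>?Q. g F)"
      using finE by (subst sum.union_disjoint[symmetric]) (auto intro!: sum.cong)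
    also have "(\<Sum>F\<in>?P. g F) = x i * (\<Sum>e\<in>G i. sum x e)"
      unfolding G_def sum.reindex[OF inj] sum_distrib_left
      by (rule sum.cong) (use conjunct2[OF two] in auto)
    also have "(\<Sum>F\<in>?Q. g F) \<le> (\<Sum>F\<in>?Q. x i * (2 * m))"
      by (rule sum_mono) (use one in auto)
    finally show ?thesis by (simp add: w_def c_def algebra_simps)
  qed
  have wle: "d * w i \<le> ?B" for i
    unfolding w_def d_def[symmetric]
  proof (rule few_edges_weight_le[OF finA t _ _ m(1,2) d0])
    show "G i \<subseteq> ksubsets 2 A" by (auto simp: G_def ksubsets_def)
    have "card (G i) + c i \<le> card {F \<in> E. r F = i \<and> card (F \<inter> A) = 2}
        + card {F \<in> E. r F = i \<and> card (F \<inter> A) \<noteq> 2}"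
      unfolding G_def c_def using finE by (simp add: card_image_le)
    also have "\<dots> = card ({F \<in> E. r F = i \<and> card (F \<inter> A) = 2}
        \<union> {F \<in> E. r F = i \<and> card (F \<inter> A) \<noteq> 2})"
      using finE by (subst card_Un_disjoint) auto
    also have "\<dots> \<le> card E" using finE by (intro card_mono) auto
    finally show "card (G i) + c i \<le> (t - 1) choose 2" using E(2) by simp
  qed
  have "(\<Sum>j\<in>A. link_sum E j x) = (\<Sum>F\<in>E. g F)"
    unfolding link_sum_def g_def by (rule sum.swap_restrict[OF finA finE])
  also have "\<dots> = (\<Sum>i\<in>D. \<Sum>F\<in>{F \<in> E. r F = i}. g F)"
    by (rule sum.group[symmetric, OF finE finD]) (use r in auto)
  also have "\<dots> \<le> (\<Sum>i\<in>D. x i * w i)" by (rule sum_mono) (rule group)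
  also have "\<dots> \<le> ?B"
  proof (cases "d = 0")
    case True
    then have "\<forall>i\<in>D. x i = 0"
      using sum_nonneg_eq_0_iff[OF finD, of x] xD unfolding d_def by simp
    then have "(\<Sum>i\<in>D. x i * w i) = 0" by simp
    \<comment> \<open>\<open>wle\<close> holds for any index whatsoever, and for
      \<open>d = 0\<close> it reads \<open>0 \<le> ?B\<close>.\<close>
    then show ?thesis using wle[of undefined] unfolding True by linarith
  next
    case False
    then have "0 < d" using d0 by simp
    then have "w i \<le> ?B / d" for i using wle[of i] by (simp only: pos_le_divide_eq mult.commute)
    then have "(\<Sum>i\<in>D. x i * w i) \<le> (\<Sum>i\<in>D. x i * (?B / d))"
      using xD by (intro sum_mono mult_left_mono) blast+
    also have "\<dots> = d * (?B / d)" unfolding d_def by (rule sum_distrib_right[symmetric])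
    also have "\<dots> = ?B" using False by simp
    finally show ?thesis .
  qed
  finally show ?thesis .
qed

section \<open>Near-cliques\<close>

text \<open>The loops are implicit: they are all vertices outside \<open>S - A\<close>.\<close>

definition near_clique :: "'a set \<Rightarrow> nat \<Rightarrow> 'a set set \<Rightarrow> 'a set \<Rightarrow> 'a set \<Rightarrow> bool" where
  "near_clique V t E S A \<longleftrightarrow> S \<subseteq> V \<and> A \<subseteq> S \<and> card A = t \<and> ksubsets 3 S \<subseteq> E \<and> E \<subseteq> ksubsets 3 V
     \<and> card (E - ksubsets 3 S) \<le> (t - 1) choose 2"

text \<open>This is the Lagrangian polynomial of the graph with triples \<open>E\<close> and a loop
  at every vertex of \<open>V - (S - A)\<close>.\<close>

definition near_clique_value ::
    "'a set \<Rightarrow> 'a set set \<Rightarrow> 'a set \<Rightarrow> 'a set \<Rightarrow> ('a \<Rightarrow> real) \<Rightarrow> real" where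
  "near_clique_value V E S A x = sum x (V - (S - A)) + 6 * edge_sum E x"

text \<open>The clique part of the links is an explicit quadratic that decreases in
  \<open>Q\<close>, the sum of squares on \<open>A\<close>. The bound for the extra triples
  increases in \<open>Q\<close> at the same rate, so \<open>Q\<close> cancels and a quadratic form
  in the weights of \<open>A\<close>, \<open>S - A\<close> and \<open>V - S\<close> remains.\<close>

lemma sum_link_sum_le:
  assumes V: "finite V" and nc: "near_clique V t E S A" and t: "t \<ge> 3"
    and x: "x \<in> weight_simplex V" "\<And>i j. i \<in> V - A \<Longrightarrow> j \<in> A \<Longrightarrow> x i \<le> x j"
    and b: "b = sum x (S - A)"
  shows "2 * real t * (\<Sum>j\<in>A. link_sum E j x)
    \<le> (real t - 1) * (real t - 2) * (1 - b)\<^sup>2 + 2 * real t * (real t - 1) * (1 - b) * b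
      + (real t)\<^sup>2 * b\<^sup>2"
proof -
  have nc': "S \<subseteq> V" "A \<subseteq> S" "card A = t" "ksubsets 3 S \<subseteq> E" "E \<subseteq> ksubsets 3 V"
    "card (E - ksubsets 3 S) \<le> (t - 1) choose 2"
    using nc by (auto simp: near_clique_def)
  have finS: "finite S" and finA: "finite A" using V nc' finite_subset by metis+
  note finE = finite_subset_ksubsets(1)[OF V nc'(5)]
  have x0: "\<And>i. i \<in> V \<Longrightarrow> 0 \<le> x i" and x1: "sum x V = 1"
    using x(1) by (auto simp: weight_simplex_def)
  define T where "T = real t"
  define Y where "Y = sum x A"
  define Q where "Q = (\<Sum>j\<in>A. (x j)\<^sup>2)"
  define d where "d = sum x (V - S)"
  have T: "T \<ge> 3" using t by (simp add: T_def)
  have SYb: "sum x S = Y + b"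
    using sum.subset_diff[OF nc'(2) finS, of x] by (simp add: Y_def b)
  then have sum1: "Y + b + d = 1"
    using sum.subset_diff[OF nc'(1) V, of x] x1 by (simp add: d_def)
  have b0: "0 \<le> b" and d0: "0 \<le> d"
    unfolding b d_def by (intro sum_nonneg; use x0 nc' in auto)+
  have split: "link_sum E j x = link_sum (ksubsets 3 S) j x + link_sum (E - ksubsets 3 S) j x" for j
  proof -
    have "{F. F \<in> E \<and> j \<in> F} = {F. F \<in> ksubsets 3 S \<and> j \<in> F} \<union> {F. F \<in> E - ksubsets 3 S \<and> j \<in> F}"
      using nc' by blast
    then show ?thesis
      unfolding link_sum_def using finE finS
      by (subst sum.union_disjoint[symmetric]) auto
  qed
  have clique: "2 * link_sum (ksubsets 3 S) j x \<le> (Y + b)\<^sup>2 - 2 * (Y + b) * x j + 2 * (x j)\<^sup>2 - Q"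
    if j: "j \<in> A" for j
  proof -
    have jS: "j \<in> S" using j nc' by auto
    have "2 * link_sum (ksubsets 3 S) j x
        = (sum x (S - {j}))\<^sup>2 - (\<Sum>i\<in>S - {j}. (x i)\<^sup>2)"
      using link_sum_ksubsets[OF finS jS, of 2 x] edge_sum_ksubsets_2[of "S - {j}" x] finS
      by (simp add: numeral_3_eq_3 numeral_2_eq_2)
    also have "sum x (S - {j}) = Y + b - x j"
      using sum.remove[OF finS jS, of x] SYb by simp
    also have "(\<Sum>i\<in>S - {j}. (x i)\<^sup>2) = (\<Sum>i\<in>S. (x i)\<^sup>2) - (x j)\<^sup>2"
      using sum.remove[OF finS jS, of "\<lambda>i. (x i)\<^sup>2"] by simp
    also have "(Y + b - x j)\<^sup>2 - ((\<Sum>i\<in>S. (x i)\<^sup>2) - (x j)\<^sup>2) \<le> (Y + b - x j)\<^sup>2 - (Q - (x j)\<^sup>2)"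
      using sum_mono2[OF finS nc'(2), of "\<lambda>i. (x i)\<^sup>2"] by (simp add: Q_def)
    finally show ?thesis by (simp add: power2_eq_square algebra_simps)
  qed
  have "2 * (\<Sum>j\<in>A. link_sum (ksubsets 3 S) j x)
      \<le> (\<Sum>j\<in>A. (Y + b)\<^sup>2 - 2 * (Y + b) * x j + 2 * (x j)\<^sup>2 - Q)"
    unfolding sum_distrib_left by (rule sum_mono) (rule clique)
  also have "\<dots> = T * (Y + b)\<^sup>2 - 2 * (Y + b) * Y - (T - 2) * Q"
    using nc'(3)
    by (simp add: sum.distrib sum_subtractf sum_distrib_left[symmetric] T_def Y_def Q_def)
      (simp add: algebra_simps)
  finally have c1: "2 * (\<Sum>j\<in>A. link_sum (ksubsets 3 S) j x)
      \<le> T * (Y + b)\<^sup>2 - 2 * (Y + b) * Y - (T - 2) * Q" .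
  have c2: "(\<Sum>j\<in>A. link_sum (E - ksubsets 3 S) j x)
      \<le> (T - 1) * (T - 2) / T * d * Y + (T - 2) / 2 * (Q - Y\<^sup>2 / T + d\<^sup>2 * (T - 1) / T)"
    unfolding T_def d_def Y_def Q_def
  proof (rule sum_link_sum_extra_le[OF V _ _ nc'(3) t _ nc'(6) _ x0 x(2)])
    show "F \<inter> (V - S) \<noteq> {}" if "F \<in> E - ksubsets 3 S" for F
      using that nc'(5) by (auto simp: ksubsets_def)
  qed (use nc' in auto)
  have "2 * T * (\<Sum>j\<in>A. link_sum E j x)
      = T * (2 * (\<Sum>j\<in>A. link_sum (ksubsets 3 S) j x) + 2 * (\<Sum>j\<in>A. link_sum (E - ksubsets 3 S) j x))"
    by (simp add: split sum.distrib algebra_simps)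
  also have "\<dots> \<le> T * ((T * (Y + b)\<^sup>2 - 2 * (Y + b) * Y - (T - 2) * Q)
      + 2 * ((T - 1) * (T - 2) / T * d * Y + (T - 2) / 2 * (Q - Y\<^sup>2 / T + d\<^sup>2 * (T - 1) / T)))"
    using c1 c2 T by (intro mult_left_mono add_mono) auto
  \<comment> \<open>The terms in \<open>Y\<close> and \<open>d\<close> complete to a square: weight
    outside \<open>S\<close> counts like weight on \<open>A\<close>, except in the cross term with
    \<open>b\<close>, where \<open>Y \<le> 1 - b\<close> suffices.\<close>
  also have "\<dots> = (T - 1) * (T - 2) * (Y + d)\<^sup>2 + 2 * T * (T - 1) * Y * b + T\<^sup>2 * b\<^sup>2"
    using T by (simp add: field_simps power2_eq_square)
  also have "\<dots> \<le> (T - 1) * (T - 2) * (1 - b)\<^sup>2 + 2 * T * (T - 1) * (1 - b) * b + T\<^sup>2 * b\<^sup>2"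
  proof -
    have "Y + d = 1 - b" "Y \<le> 1 - b" using sum1 d0 by auto
    then show ?thesis using b0 T by (simp add: mult_left_mono mult_right_mono)
  qed
  finally show ?thesis by (simp add: T_def)
qed

text \<open>The hypothesis \<open>t \<ge> 5\<close> enters through \<open>t\<^sup>2 - 6 t + 6 > 0\<close>, which makes weight on \<open>S - A\<close> unprofitable.\<close>

lemma near_clique_value_le_of_maximal:
  assumes V: "finite V" and nc: "near_clique V t E S A" and t: "t \<ge> 5"
    and x: "x \<in> weight_simplex V" "\<And>i j. i \<in> V - A \<Longrightarrow> j \<in> A \<Longrightarrow> x i \<le> x j"
    and max: "\<And>y. y \<in> weight_simplex V \<Longrightarrow> near_clique_value V E S A y \<le> near_clique_value V E S A x"
  shows "near_clique_value V E S A x \<le> 1 + (real t - 1) * (real t - 2) / (real t)\<^sup>2"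
proof -
  have nc': "S \<subseteq> V" "A \<subseteq> S" "card A = t" "ksubsets 3 S \<subseteq> E" "E \<subseteq> ksubsets 3 V"
    using nc by (auto simp: near_clique_def)
  have finS: "finite S" and finA: "finite A" using V nc' finite_subset by metis+
  note finE = finite_subset_ksubsets(1)[OF V nc'(5)]
  have x0: "\<And>i. i \<in> V \<Longrightarrow> 0 \<le> x i" and x1: "sum x V = 1"
    using x(1) by (auto simp: weight_simplex_def)
  define b where "b = sum x (S - A)"
  have L: "sum x (V - (S - A)) = 1 - b"
    using sum_diff[of V "S - A" x] V nc' x1 by (auto simp: b_def)
  have b: "0 \<le> b" unfolding b_def by (rule sum_nonneg) (use x0 nc' in auto)
  show ?thesis
  proof (cases "\<exists>j\<in>A. x j = 0")
    \<comment> \<open>First-order optimality is available only at positive weights. Here, however,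
      \<open>A\<close> contains a vertex of weight 0, so all weights outside \<open>A\<close> vanish
      and only the clique on \<open>A\<close> counts.\<close>
    case True
    then have out: "x i = 0" if "i \<in> V - A" for i
      using x(2)[OF that] x0[of i] that by force
    have AV: "A \<subseteq> V" using nc' by auto
    have xA: "sum x A = 1"
      using sum.mono_neutral_right[OF V AV, of x] out x1 by simp
    have "edge_sum E x = edge_sum (ksubsets 3 A) x"
      unfolding edge_sum_def
    proof (rule sum.mono_neutral_right[OF finE])
      show "ksubsets 3 A \<subseteq> E" using nc'(2,4) unfolding ksubsets_def by blast
      show "\<forall>F\<in>E - ksubsets 3 A. (\<Prod>i\<in>F. x i) = 0"
      proof
        fix F assume "F \<in> E - ksubsets 3 A"
        then have "F \<in> E" "card F = 3" "F \<subseteq> V" "\<not> F \<subseteq> A"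
          using nc'(5) by (auto simp: ksubsets_def)
        then obtain i where "i \<in> F" "i \<in> V - A" "finite F"
          using finite_subset_ksubsets(2)[OF V nc'(5)] by blast
        then show "(\<Prod>i\<in>F. x i) = 0" using out by (auto simp: prod_zero_iff)
      qed
    qed
    moreover have "6 * edge_sum (ksubsets 3 A) x \<le> (real t - 1) * (real t - 2) / (real t)\<^sup>2"
      by (rule edge_sum_ksubsets_3_le[OF finA nc'(3) _ _ xA]) (use t x0 AV in auto)
    ultimately show ?thesis
      using L b by (simp add: near_clique_value_def)
  next
    case False
    then have pos: "0 < x j" if "j \<in> A" for j
      using x0[of j] that nc' by force
    define \<Sigma> where "\<Sigma> = edge_sum E x"
    define T where "T = real t"
    have T: "T \<ge> 5" using t by (simp add: T_def)
    have link: "18 * \<Sigma> - b \<le> 6 * link_sum E j x" if "j \<in> A" for j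
      using link_sum_ge_of_maximal[OF V nc'(5) _ x(1) max[unfolded near_clique_value_def], of j]
        that nc' pos[OF that] L by (auto simp: \<Sigma>_def)
    have "(\<Sum>j\<in>A. 18 * \<Sigma> - b) \<le> (\<Sum>j\<in>A. 6 * link_sum E j x)"
      by (rule sum_mono) (rule link)
    then have "T * (18 * \<Sigma> - b) \<le> 6 * (\<Sum>j\<in>A. link_sum E j x)"
      using nc'(3) by (simp add: T_def sum_distrib_left)
    then have "T * (T * (18 * \<Sigma> - b)) \<le> T * (6 * (\<Sum>j\<in>A. link_sum E j x))"
      using T by (intro mult_left_mono) auto
    also have "\<dots> \<le> 3 * ((T - 1) * (T - 2) * (1 - b)\<^sup>2 + 2 * T * (T - 1) * (1 - b) * b + T\<^sup>2 * b\<^sup>2)"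
      using sum_link_sum_le[OF V nc _ x b_def] t by (simp add: T_def)
    \<comment> \<open>The term \<open>2 * T\<^sup>2 * b\<close> is split off because, moved to the
      left, it turns \<open>18 * \<Sigma> - b\<close> into \<open>3 * (6 * \<Sigma> - b)\<close>,
      and \<open>6 * \<Sigma> - b\<close> is the value at \<open>x\<close> minus 1.\<close>
    also have "\<dots> = 3 * (T - 1) * (T - 2) + 2 * T\<^sup>2 * b - 2 * (T\<^sup>2 - 6 * T + 6) * b - 3 * (T - 2) * b\<^sup>2"
      by (simp add: power2_eq_square algebra_simps)
    also have "\<dots> \<le> 3 * (T - 1) * (T - 2) + 2 * T\<^sup>2 * b"
    proof -
      have "0 \<le> (T - 5) * (T - 1) + 1" using T by simp
      then have "0 \<le> T\<^sup>2 - 6 * T + 6" by (simp add: power2_eq_square algebra_simps)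
      then have "0 \<le> 2 * (T\<^sup>2 - 6 * T + 6) * b" "0 \<le> 3 * (T - 2) * b\<^sup>2" using b T by auto
      then show ?thesis by linarith
    qed
    finally have "T\<^sup>2 * (6 * \<Sigma> - b) \<le> (T - 1) * (T - 2)"
      by (simp add: power2_eq_square algebra_simps)
    then have "6 * \<Sigma> - b \<le> (T - 1) * (T - 2) / T\<^sup>2"
      using T by (simp add: pos_le_divide_eq mult.commute)
    then show ?thesis using L by (simp add: near_clique_value_def \<Sigma>_def T_def)
  qed
qed

text \<open>The usual shift: in a triple containing \<open>j\<close> but not \<open>i\<close>,
  \<open>j\<close> is replaced by \<open>i\<close> unless the result is already a triple. The shift
  is injective on the moved triples, so \<open>card E\<close> is kept, and no product decreases
  since \<open>x j \<le> x i\<close>. The set \<open>S - A\<close>, and with it the loop part of the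
  value, is unchanged.\<close>

lemma near_clique_compress:
  assumes V: "finite V" and nc: "near_clique V t E S A" and j: "j \<in> A" and i: "i \<in> V - S"
    and x: "\<And>k. k \<in> V \<Longrightarrow> 0 \<le> x k" "x j \<le> x i"
  obtains E' where "near_clique V t E' (insert i (S - {j})) (insert i (A - {j}))"
    "near_clique_value V E S A x \<le> near_clique_value V E' (insert i (S - {j})) (insert i (A - {j})) x"
proof -
  have nc': "S \<subseteq> V" "A \<subseteq> S" "card A = t" "ksubsets 3 S \<subseteq> E" "E \<subseteq> ksubsets 3 V"
    "card (E - ksubsets 3 S) \<le> (t - 1) choose 2"
    using nc by (auto simp: near_clique_def)
  have finS: "finite S" and finA: "finite A" using V nc' finite_subset by metis+
  note finE = finite_subset_ksubsets(1)[OF V nc'(5)] and finF = finite_subset_ksubsets(2)[OF V nc'(5)]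
  have ij: "i \<noteq> j" "j \<in> S" "i \<notin> S" "i \<in> V" using i j nc' by auto
  define c where "c F = insert i (F - {j})" for F
  define Out where "Out = {F \<in> E. j \<in> F \<and> i \<notin> F \<and> c F \<notin> E}"
  define E' where "E' = (E - Out) \<union> c ` Out"
  have OutE: "Out \<subseteq> E" by (auto simp: Out_def)
  have finO: "finite Out" using finE OutE finite_subset by blast
  have inj: "inj_on c Out"
  proof (rule inj_onI)
    fix F G assume "F \<in> Out" "G \<in> Out" "c F = c G"
    moreover from this have "F = insert j (c F - {i})" "G = insert j (c G - {i})"
      using ij by (auto simp: Out_def c_def)
    ultimately show "F = G" by simp
  qed
  have disj: "(E - Out) \<inter> c ` Out = {}" by (auto simp: Out_def)
  have cardc: "card (c F) = card F" if "j \<in> F" "i \<notin> F" "finite F" for F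
    using that by (metis Diff_iff card_Suc_Diff1 card_insert_disjoint c_def finite_Diff)
  have E'V: "E' \<subseteq> ksubsets 3 V"
  proof
    fix F assume "F \<in> E'"
    then consider "F \<in> E" | G where "G \<in> Out" "F = c G" by (auto simp: E'_def)
    then show "F \<in> ksubsets 3 V"
    proof cases
      case 2
      then show ?thesis
        using nc'(5) OutE ij(4) cardc[of G] finF[of G] by (auto simp: Out_def ksubsets_def c_def)
    qed (use nc'(5) in auto)
  qed
  have cardE': "card E' = card E"
  proof -
    have "card E' = card (E - Out) + card Out"
      unfolding E'_def using disj finE finO inj by (simp add: card_Un_disjoint card_image)
    also have "\<dots> = card E" using OutE finE card_mono[OF finE OutE] by (simp add: card_Diff_subset finO)
    finally show ?thesis .
  qed
  have cS: "card (c S) = card S" and cA: "card (c A) = card A"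
    using cardc ij j nc' finS finA by auto
  have clique: "ksubsets 3 (c S) \<subseteq> E'"
  proof
    fix F assume F: "F \<in> ksubsets 3 (c S)"
    have jF: "j \<notin> F" using F ij by (auto simp: ksubsets_def c_def)
    show "F \<in> E'"
    proof (cases "i \<in> F")
      case False
      then have "F \<in> ksubsets 3 S" using F by (auto simp: ksubsets_def c_def)
      then show ?thesis using nc' jF by (auto simp: E'_def Out_def)
    next
      case True
      \<comment> \<open>\<open>G\<close> is the preimage of \<open>F\<close> under the shift and
        lies in \<open>S\<close>, hence in \<open>E\<close>. Either it was moved to
        \<open>F\<close>, or \<open>F\<close> was a triple before.\<close>
      define G where "G = insert j (F - {i})"
      have finF': "finite F" using F finS by (auto simp: ksubsets_def c_def dest: finite_subset)
      have "card G = 3"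
        using F True jF finF' by (simp add: G_def ksubsets_def card.insert_remove card_Diff_singleton)
      moreover have "G \<subseteq> S" using F ij by (auto simp: G_def ksubsets_def c_def)
      ultimately have "G \<in> E" using nc' by (auto simp: ksubsets_def)
      moreover have "c G = F" "j \<in> G" "i \<notin> G" using True jF ij by (auto simp: G_def c_def)
      ultimately have "F \<in> E \<or> F \<in> c ` Out" unfolding Out_def by blast
      then show ?thesis using True by (auto simp: E'_def Out_def)
    qed
  qed
  \<comment> \<open>Both families have the same size and contain all triples of a set of size
    \<open>card S\<close>, so equally many triples are left over.\<close>
  have "card (E' - ksubsets 3 (c S)) = card (E - ksubsets 3 S)"
  proof -
    have "finite (c S)" using finS by (simp add: c_def)
    then show ?thesis
      using clique nc'(4) finS cardE' cS by (simp add: card_Diff_subset) (simp add: ksubsets_def n_subsets)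
  qed
  then have "near_clique V t E' (c S) (c A)"
    unfolding near_clique_def using nc' ij(4) cA clique E'V by (auto simp: c_def)
  moreover have "near_clique_value V E S A x \<le> near_clique_value V E' (c S) (c A) x"
  proof -
    have "(\<Prod>k\<in>F. x k) \<le> (\<Prod>k\<in>c F. x k)" if F: "F \<in> Out" for F
    proof -
      have "j \<in> F" "i \<notin> F" "finite F" "F \<subseteq> V"
        using F finF nc'(5) by (auto simp: Out_def ksubsets_def)
      then show ?thesis
        using x by (simp add: c_def prod.remove[of F j]) (intro mult_right_mono prod_nonneg, auto)
    qed
    then have "edge_sum Out x \<le> edge_sum (c ` Out) x"
      unfolding edge_sum_def sum.reindex[OF inj] by (auto intro: sum_mono)
    moreover have "edge_sum E' x = edge_sum (E - Out) x + edge_sum (c ` Out) x"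
      unfolding edge_sum_def E'_def using disj finE finO by (simp add: sum.union_disjoint)
    moreover have "edge_sum E x = edge_sum (E - Out) x + edge_sum Out x"
      unfolding edge_sum_def by (rule sum.subset_diff[OF OutE finE])
    moreover have "c S - c A = S - A" using ij j by (auto simp: c_def)
    ultimately show ?thesis by (simp add: near_clique_value_def)
  qed
  ultimately show ?thesis using that by (simp add: c_def)
qed

section \<open>Lagrangians of graphs with loops and triples\<close>

text \<open>Assuming only an inclusion spares a proof that both edge types occur; an absent type
  contributes an empty sum.\<close>

lemma lagrangian_poly_1_3:
  assumes H: "hypergraph H" and ty: "edge_types H \<subseteq> {1, 3}"
  shows "lagrangian_poly H x
    = sum x {v. {v} \<in> edges H} + 6 * edge_sum {F \<in> edges H. card F = 3} x"
proof -
  have "lagrangian_poly H x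
      = (\<Sum>j\<in>{1, 3}. fact j * (\<Sum>F\<in>edges (uniform_part H j). \<Prod>i\<in>F. x i))"
    unfolding lagrangian_poly_def
  proof (rule sum.mono_neutral_left)
    show "\<forall>j\<in>{1, 3} - edge_types H. fact j * (\<Sum>F\<in>edges (uniform_part H j). \<Prod>i\<in>F. x i) = 0"
    proof
      fix j assume "j \<in> {1, 3} - edge_types H"
      then have "edges (uniform_part H j) = {}"
        by (auto simp: uniform_part_def edge_types_def)
      then show "fact j * (\<Sum>F\<in>edges (uniform_part H j). \<Prod>i\<in>F. x i) = 0" by simp
    qed
  qed (use ty in auto)
  also have "\<dots> = (\<Sum>F | F \<in> edges H \<and> card F = 1. \<Prod>i\<in>F. x i)
      + 6 * edge_sum {F \<in> edges H. card F = 3} x"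
    by (simp add: uniform_part_def edge_sum_def fact_numeral)
  also have "(\<Sum>F | F \<in> edges H \<and> card F = 1. \<Prod>i\<in>F. x i) = sum x {v. {v} \<in> edges H}"
    by (rule sum.reindex_bij_witness[where i = "\<lambda>v. {v}" and j = the_elem])
      (auto simp: card_1_singleton_iff)
  finally show ?thesis .
qed

section \<open>Extremal near-cliques\<close>

lemma near_clique_value_attains_max:
  assumes V: "finite V" "V \<noteq> {}" and nc: "near_clique V t E S A"
  shows "\<exists>x\<in>weight_simplex V. \<forall>y\<in>weight_simplex V.
    near_clique_value V E S A y \<le> near_clique_value V E S A x"
proof -
  define H where "H = (V, (\<lambda>v. {v}) ` (V - (S - A)) \<union> E)"
  have E: "E \<subseteq> ksubsets 3 V" using nc by (auto simp: near_clique_def)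
  have "hypergraph H" "edge_types H \<subseteq> {1, 3}"
    using V E by (auto simp: H_def hypergraph_def edge_types_def ksubsets_def)
  moreover have "{v. {v} \<in> edges H} = V - (S - A)" "{F \<in> edges H. card F = 3} = E"
    using E by (auto simp: H_def ksubsets_def)
  ultimately have "lagrangian_poly H = near_clique_value V E S A"
    by (auto simp: lagrangian_poly_1_3 near_clique_value_def)
  then show ?thesis
    using lagrangian_poly_attains_max[OF \<open>hypergraph H\<close>] V by (simp add: H_def)
qed

lemma finite_maximizer:
  fixes h :: "'b \<Rightarrow> real"
  assumes "finite C" "C \<noteq> {}"
  obtains p where "p \<in> C" "\<And>q. q \<in> C \<Longrightarrow> h q \<le> h p"
proof -
  have "Max (h ` C) \<in> h ` C" using assms by simp
  then obtain p where "p \<in> C" "h p = Max (h ` C)" by auto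
  then show ?thesis using that assms by simp
qed

text \<open>The largest value \<open>m\<close> is attained by some near-clique at a weighting
  \<open>x\<close>, which then stays fixed. If a vertex outside \<open>A1\<close> were heavier than
  one in \<open>A1\<close>, an exchange inside \<open>S1\<close> would exceed \<open>m\<close>, and
  a compression from outside \<open>S1\<close> would keep \<open>m\<close> but make
  \<open>A1\<close> heavier. Both contradict the choice of \<open>p1\<close>, so
  \<open>near_clique_value_le_of_maximal\<close> applies to it.\<close>

lemma near_clique_value_le:
  assumes V: "finite V" and nc: "near_clique V t E S A" and t: "t \<ge> 5"
    and y: "y \<in> weight_simplex V"
  shows "near_clique_value V E S A y \<le> 1 + (real t - 1) * (real t - 2) / (real t)\<^sup>2"
proof -
  have Vne: "V \<noteq> {}" using nc t by (auto simp: near_clique_def)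
  define C where "C = {(E, S, A). near_clique V t E S A}"
  define val where "val p = (case p of (E, S, A) \<Rightarrow> near_clique_value V E S A)" for p
  have "C \<subseteq> Pow (Pow V) \<times> Pow V \<times> Pow V"
    by (auto simp: C_def near_clique_def ksubsets_def)
  then have finC: "finite C" using V finite_subset by fastforce
  have C: "(E, S, A) \<in> C" using nc by (simp add: C_def)
  have "\<forall>p\<in>C. \<exists>x. x \<in> weight_simplex V \<and> (\<forall>y\<in>weight_simplex V. val p y \<le> val p x)"
    using near_clique_value_attains_max[OF V Vne] by (fastforce simp: C_def val_def)
  then obtain X where X: "\<And>p. p \<in> C \<Longrightarrow> X p \<in> weight_simplex V"
    "\<And>p y. p \<in> C \<Longrightarrow> y \<in> weight_simplex V \<Longrightarrow> val p y \<le> val p (X p)"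
    by metis
  obtain p0 where p0: "p0 \<in> C" "\<And>q. q \<in> C \<Longrightarrow> val q (X q) \<le> val p0 (X p0)"
    using finite_maximizer[of C "\<lambda>p. val p (X p)"] finC C by blast
  define x where "x = X p0"
  define m where "m = val p0 x"
  have x: "x \<in> weight_simplex V" using X p0 by (simp add: x_def)
  have m: "val p z \<le> m" if "p \<in> C" "z \<in> weight_simplex V" for p z
    using X(2)[OF that] p0(2)[OF that(1)] by (simp add: m_def x_def)
  \<comment> \<open>Compression only guarantees that the value does not drop, so ties at
    \<open>x\<close> are broken by the weight of \<open>A\<close>.\<close>
  define C1 where "C1 = {p \<in> C. val p x = m}"
  have "p0 \<in> C1" using p0(1) by (simp add: C1_def m_def)
  then have "C1 \<noteq> {}" by blast
  moreover have "finite C1" using finC by (simp add: C1_def)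
  ultimately obtain p1 where p1': "p1 \<in> C1"
    "\<And>q. q \<in> C1 \<Longrightarrow> sum x (snd (snd q)) \<le> sum x (snd (snd p1))"
    using finite_maximizer[of C1 "\<lambda>p. sum x (snd (snd p))"] by blast
  then have p1: "p1 \<in> C" "val p1 x = m"
    "\<And>q. q \<in> C \<Longrightarrow> val q x = m \<Longrightarrow> sum x (snd (snd q)) \<le> sum x (snd (snd p1))"
    by (simp_all add: C1_def)
  obtain E1 S1 A1 where [simp]: "p1 = (E1, S1, A1)" by (cases p1)
  have nc1: "near_clique V t E1 S1 A1" using p1 by (simp add: C_def)
  then have SA: "S1 \<subseteq> V" "A1 \<subseteq> S1" "card A1 = t" by (auto simp: near_clique_def)
  have finA: "finite A1" using SA V finite_subset by metis
  have order: "x i \<le> x j" if i: "i \<in> V - A1" and j: "j \<in> A1" for i j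
  proof (rule ccontr)
    assume "\<not> x i \<le> x j"
    then have lt: "x j < x i" by simp
    have "i \<noteq> j" using i j by auto
    have sumA: "sum x (insert i (A1 - {j})) = sum x A1 - x j + x i"
      using i j finA by (simp add: sum.remove[of A1 j])
    show False
    proof (cases "i \<in> S1")
      case True
      let ?A = "insert i (A1 - {j})"
      have "card ?A = t" using i j finA SA(3) card_Suc_Diff1[OF finA j] by simp
      then have "near_clique V t E1 S1 ?A"
        using nc1 True by (auto simp: near_clique_def)
      then have "val (E1, S1, ?A) x \<le> m" using m x by (simp add: C_def)
      \<comment> \<open>The triples stay the same while a loop passes from \<open>j\<close> to the
        heavier \<open>i\<close>, so the value would rise above \<open>m\<close>.\<close>
      moreover have "V - (S1 - ?A) = insert i ((V - (S1 - A1)) - {j})"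
        using True i j SA \<open>i \<noteq> j\<close> by auto
      then have "sum x (V - (S1 - ?A)) = sum x (V - (S1 - A1)) - x j + x i"
        using V True i j SA by (simp add: sum.remove[of "V - (S1 - A1)" j] subset_iff)
      ultimately show False
        using p1(2) lt by (simp add: val_def near_clique_value_def)
    next
      case False
      then have "i \<in> V - S1" using i by simp
      then obtain E2 where E2: "near_clique V t E2 (insert i (S1 - {j})) (insert i (A1 - {j}))"
        "near_clique_value V E1 S1 A1 x
           \<le> near_clique_value V E2 (insert i (S1 - {j})) (insert i (A1 - {j})) x"
        using near_clique_compress[OF V nc1 j, of i x] x lt by (auto simp: weight_simplex_def)
      let ?p = "(E2, insert i (S1 - {j}), insert i (A1 - {j}))"
      have "?p \<in> C" using E2 by (simp add: C_def)
      moreover from this have "val ?p x = m"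
        using m[OF _ x, of ?p] E2(2) p1(2) by (simp add: val_def)
      ultimately have "sum x (insert i (A1 - {j})) \<le> sum x A1" using p1(3)[of ?p] by simp
      then show False using sumA lt by simp
    qed
  qed
  have "val (E, S, A) y \<le> m" by (rule m[OF C y])
  also have "m \<le> 1 + (real t - 1) * (real t - 2) / (real t)\<^sup>2"
    using near_clique_value_le_of_maximal[OF V nc1 t x order] m[of p1] p1 by (simp add: val_def)
  finally show ?thesis by (simp add: val_def)
qed

text \<open>From above, adding loops embeds \<open>H\<close> in a near-clique without lowering the
  polynomial. From below, the uniform weighting on \<open>T\<close> reaches the bound.\<close>

lemma lagrangian_eq_of_near_clique:
  assumes H: "hypergraph H" "edge_types H \<subseteq> {1, 3}" and t: "t \<ge> 5"
    and T: "complete_subgraph {1, 3} H T" "card T = t"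
    and S: "S \<subseteq> verts H" "ksubsets 3 S \<subseteq> edges H" "card {v \<in> S. {v} \<in> edges H} \<le> t" "t \<le> card S"
    and extra: "card ({F \<in> edges H. card F = 3} - ksubsets 3 S) \<le> (t - 1) choose 2"
  shows "lagrangian H = 1 + (real t - 1) * (real t - 2) / (real t)\<^sup>2"
proof (rule antisym)
  define V where "V = verts H"
  define E where "E = {F \<in> edges H. card F = 3}"
  define L where "L = {v. {v} \<in> edges H}"
  have V: "finite V" and EV: "edges H \<subseteq> Pow V" using H by (auto simp: V_def hypergraph_def)
  have finS: "finite S" using S V finite_subset by (auto simp: V_def)
  have E: "E \<subseteq> ksubsets 3 V" using EV by (auto simp: E_def ksubsets_def)
  have LV: "L \<subseteq> V" using EV by (auto simp: L_def)
  have TV: "T \<subseteq> V" using T by (auto simp: complete_subgraph_def V_def)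
  have finT: "finite T" using TV V finite_subset by blast
  have Vne: "verts H \<noteq> {}" using TV T(2) t by (auto simp: V_def)
  have poly: "lagrangian_poly H x = sum x L + 6 * edge_sum E x" for x
    unfolding L_def E_def by (rule lagrangian_poly_1_3[OF H])
  note max = lagrangian_is_max[OF H(1) Vne]
  show "lagrangian H \<le> 1 + (real t - 1) * (real t - 2) / (real t)\<^sup>2"
  proof -
    \<comment> \<open>Since \<open>A\<close> contains every looped vertex of \<open>S\<close>, all
      loops of \<open>H\<close> lie in \<open>V - (S - A)\<close>.\<close>
    obtain A where A: "{v \<in> S. {v} \<in> edges H} \<subseteq> A" "A \<subseteq> S" "card A = t"
      using exists_subset_between[OF S(3,4) _ finS] by auto
    have nc: "near_clique V t E S A"
      using S A extra E by (auto simp: near_clique_def V_def E_def ksubsets_def)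
    obtain x where x: "x \<in> weight_simplex V" "lagrangian H = lagrangian_poly H x"
      using max(1) by (auto simp: V_def)
    have "sum x L \<le> sum x (V - (S - A))"
      by (rule sum_mono2) (use V LV A x in \<open>auto simp: L_def weight_simplex_def\<close>)
    then have "lagrangian H \<le> near_clique_value V E S A x"
      using x poly by (simp add: near_clique_value_def)
    also note near_clique_value_le[OF V nc t x(1)]
    finally show ?thesis .
  qed
  show "1 + (real t - 1) * (real t - 2) / (real t)\<^sup>2 \<le> lagrangian H"
  proof -
    define x where "x i = (if i \<in> T then 1 / real t else 0)" for i
    have xT: "sum x T = 1" "(\<Sum>i\<in>T. (x i)\<^sup>2) = 1 / real t" "(\<Sum>i\<in>T. (x i) ^ 3) = 1 / (real t)\<^sup>2"
      using T(2) t by (simp_all add: x_def power2_eq_square power3_eq_cube)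
    have x0: "0 \<le> x i" for i by (simp add: x_def)
    have "sum x V = sum x T"
      by (rule sum.mono_neutral_right[OF V TV]) (simp add: x_def)
    then have xV: "x \<in> weight_simplex V" using x0 xT by (simp add: weight_simplex_def)
    have "T \<subseteq> L" "ksubsets 3 T \<subseteq> E"
      using T by (auto simp: complete_subgraph_def L_def E_def ksubsets_def)
    then have "sum x T \<le> sum x L" "edge_sum (ksubsets 3 T) x \<le> edge_sum E x"
      unfolding edge_sum_def
      using x0 finite_subset[OF LV V] finite_subset[OF E finite_ksubsets[OF V]]
      by (auto intro!: sum_mono2 prod_nonneg)
    then have "1 + 6 * edge_sum (ksubsets 3 T) x \<le> lagrangian H"
      using max(2)[of x] xV xT(1) poly[of x] by (simp add: V_def)
    moreover have "(real t - 1) * (real t - 2) / (real t)\<^sup>2 = 1 - 3 * (1 / real t) + 2 * (1 / (real t)\<^sup>2)"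
      using t by (simp add: field_simps power2_eq_square)
    ultimately show ?thesis
      using edge_sum_ksubsets_3[OF finT, of x] xT by simp
  qed
qed

section \<open>Maximum complete subgraphs and the final equality\<close>

lemma max_complete_order_attained:
  assumes "finite (verts H)" "0 \<notin> R"
  shows "\<exists>T. complete_subgraph R H T \<and> card T = max_complete_order R H"
    and "complete_subgraph R H T \<Longrightarrow> card T \<le> max_complete_order R H"
proof -
  let ?C = "{card T | T. complete_subgraph R H T}"
  have "?C \<subseteq> card ` Pow (verts H)" by (auto simp: complete_subgraph_def)
  then have fin: "finite ?C" using assms finite_subset by fastforce
  \<comment> \<open>The condition \<open>0 \<notin> R\<close> makes the empty set complete, so
    \<open>Max\<close> is taken over a nonempty set.\<close>
  have "complete_subgraph R H {}" using assms by (auto simp: complete_subgraph_def)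
  then have "?C \<noteq> {}" by blast
  from Max_in[OF fin this] show "\<exists>T. complete_subgraph R H T \<and> card T = max_complete_order R H"
    by (auto simp: max_complete_order_def)
  show "card T \<le> max_complete_order R H" if "complete_subgraph R H T"
    unfolding max_complete_order_def by (rule Max_ge[OF fin]) (use that in blast)
qed

text \<open>Here \<open>{1..t}\<close> serves both as the clique of triples and as the complete
  subgraph, and no extra triples exist.\<close>

lemma lagrangian_complete_hypergraph_1_3:
  assumes "t \<ge> 5"
  shows "lagrangian (complete_hypergraph {1, 3} t) = 1 + (real t - 1) * (real t - 2) / (real t)\<^sup>2"
proof (rule lagrangian_eq_of_near_clique[OF _ _ assms, where T = "{1..t}" and S = "{1..t}"])
  show "card {v \<in> {1..t}. {v} \<in> edges (complete_hypergraph {1, 3} t)} \<le> t"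
    using card_mono[of "{1..t}" "{v \<in> {1..t}. {v} \<in> edges (complete_hypergraph {1, 3} t)}"]
    by (metis (no_types, lifting) card_atLeastAtMost diff_Suc_1 finite_atLeastAtMost mem_Collect_eq subsetI)
  have "{F \<in> edges (complete_hypergraph {1, 3} t). card F = 3} - ksubsets 3 {1..t} = {}"
    by (auto simp: complete_hypergraph_def ksubsets_def)
  then show "card ({F \<in> edges (complete_hypergraph {1, 3} t). card F = 3} - ksubsets 3 {1..t})
      \<le> (t - 1) choose 2"
    by (simp only: card.empty)
qed (auto simp: complete_hypergraph_def hypergraph_def edge_types_def complete_subgraph_def ksubsets_def)

theorem theorem1p5:
  fixes H :: "nat hypergraph" and n s t :: nat
  assumes "R_graph {1, 3} H"
    and "verts H = {1..n}"
    and "max_complete_order {1, 3} H = t"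
    and "t \<ge> 5"
    and "max_complete_order {3} (uniform_part H 3) = s"
    and "s \<ge> t"
    and "s choose 3 \<le> num_edges (uniform_part H 3)"
    and "num_edges (uniform_part H 3) \<le> (s choose 3) + ((t - 1) choose 2)"
  shows "lagrangian H = lagrangian (complete_hypergraph {1, 3} t) \<and>
    lagrangian (complete_hypergraph {1, 3} t) = 1 + (real t - 1) * (real t - 2) / (real t)\<^sup>2"
proof -
  have H: "hypergraph H" "edge_types H \<subseteq> {1, 3}" using assms(1) by (auto simp: R_graph_def)
  have fin: "finite (verts H)" "finite (verts (uniform_part H 3))"
    using assms(2) by (simp_all add: uniform_part_def)
  obtain T where T: "complete_subgraph {1, 3} H T" "card T = t"
    using max_complete_order_attained(1)[OF fin(1), of "{1, 3}"] assms(3) by auto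
  obtain S where S: "complete_subgraph {3} (uniform_part H 3) S" "card S = s"
    using max_complete_order_attained(1)[OF fin(2), of "{3}"] assms(5) by auto
  have SV: "S \<subseteq> verts H" and SE: "ksubsets 3 S \<subseteq> edges H"
    using S(1) by (auto simp: complete_subgraph_def uniform_part_def ksubsets_def)
  have finS: "finite S" using SV fin finite_subset by blast
  \<comment> \<open>The looped vertices of \<open>S\<close> inherit all triples from the clique
    \<open>S\<close>, so they span a complete subgraph and there are at most \<open>t\<close> of
    them.\<close>
  have "complete_subgraph {1, 3} H {v \<in> S. {v} \<in> edges H}"
    unfolding complete_subgraph_def
  proof (intro conjI allI impI)
    fix F assume F: "F \<subseteq> {v \<in> S. {v} \<in> edges H} \<and> card F \<in> {1, 3}"
    then consider "card F = 1" | "card F = 3" by auto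
    then show "F \<in> edges H"
    proof cases
      case 1
      then show ?thesis using F by (auto simp: card_1_singleton_iff)
    next
      case 2
      then show ?thesis using F SE by (auto simp: ksubsets_def)
    qed
  qed (use SV in auto)
  then have loops: "card {v \<in> S. {v} \<in> edges H} \<le> t"
    using max_complete_order_attained(2)[OF fin(1), of "{1, 3}"] assms(3) by auto
  have "card ({F \<in> edges H. card F = 3} - ksubsets 3 S)
      = card {F \<in> edges H. card F = 3} - (s choose 3)"
    using SE finS S(2)
    by (subst card_Diff_subset) (auto simp: ksubsets_def n_subsets)
  then have extra: "card ({F \<in> edges H. card F = 3} - ksubsets 3 S) \<le> (t - 1) choose 2"
    using assms(8) by (simp add: num_edges_def uniform_part_def)
  have "lagrangian H = 1 + (real t - 1) * (real t - 2) / (real t)\<^sup>2"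
    using lagrangian_eq_of_near_clique[OF H assms(4) T SV SE loops _ extra] S(2) assms(6) by simp
  then show ?thesis using lagrangian_complete_hypergraph_1_3[OF assms(4)] by simp
qed

end
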